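(* Let $X$ be a compact Hausdorff topological space. Suppose that for some $x_0\in X$ there exists a continuous injective monoid homomorphism $F:([0,1],\times)\to(C_{x_0}(X),\circ)$ such that (1) $F(0)$ is the constant map with value $x_0$; (2) $F(1)=\mathrm{Id}_X$; (3) $F(\alpha)$ is injective for all $\alpha\in(0,1]$. Let $F[0,1)(X)=\bigcup_{\alpha\in[0,1)}F(\alpha)(X)$ and $C=X\setminus F[0,1)(X)$. Then $\{F(\alpha)(C)\}_{\alpha\in[0,1]}$ is a partition of $X$ (the sets are nonempty, pairwise disjoint for distinct $\alpha$, and cover $X$). If moreover $F[0,1)(X)$ is an open subset of $X$, then the function $f':\mathcal{C}_{x_0}([0,1],C)\to X$ defined by $x_0\mapsto x_0$ and $(\alpha,c)\mapsto F(\alpha)(c)$ for $\alpha\in(0,1]$, $c\in C$, is a homeomorphism.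
   Context: $C_{x_0}(X)$ is the set of continuous maps $f:X\to X$ with $f(x_0)=x_0$, a monoid under composition, equipped with the subspace topology induced by the compact-open topology on the space of continuous maps $X\to X$. The monoid $([0,1],\times)$ is $[0,1]$ with multiplication and the usual topology. Cone: for a topological space $C$, a set $I\subset\mathbb{R}_{\ge0}$ containing $0$, and a point $p$, $\mathcal{C}_p(I,C)$ is the quotient space obtained from $I\times C$ by identifying $\{0\}\times C$ to the single point $p$; as a set it is $\{p\}\sqcup (I\setminus\{0\})\times C$, and it carries the quotient topology. Here $C\subset X$ has the subspace topology. *)

theory Defs
  imports "HOL-Analysis.Analysis" "HOL-Algebra.Group"
begin

(* Continuous maps between abstract topologies are represented as extensional functions,
   so that equality of functions is equality of maps on topspace X. *)
definition cmaps :: "'a topology \<Rightarrow> 'b topology \<Rightarrow> ('a \<Rightarrow> 'b) set" where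
  "cmaps X Y = {f \<in> extensional (topspace X). continuous_map X Y f}"

definition compact_open_topology :: "'a topology \<Rightarrow> 'b topology \<Rightarrow> ('a \<Rightarrow> 'b) topology" where
  "compact_open_topology X Y =
     topology_generated_by
       {{f \<in> cmaps X Y. f ` K \<subseteq> U} | K U. compactin X K \<and> openin Y U}"

lemma topspace_compact_open_topology [simp]:
  "topspace (compact_open_topology X Y) = cmaps X Y"
proof -
  have "cmaps X Y \<in> {{f \<in> cmaps X Y. f ` K \<subseteq> U} | K U. compactin X K \<and> openin Y U}"
    by (rule CollectI, rule exI[of _ "{}"], rule exI[of _ "{}"]) auto
  then show ?thesis
    unfolding compact_open_topology_def topology_generated_by_topspace by blast
qed

definition pointed_maps :: "'a topology \<Rightarrow> 'a \<Rightarrow> ('a \<Rightarrow> 'a) set" where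
  "pointed_maps X x\<^sub>0 = {f \<in> cmaps X X. f x\<^sub>0 = x\<^sub>0}"

definition pointed_maps_topology :: "'a topology \<Rightarrow> 'a \<Rightarrow> ('a \<Rightarrow> 'a) topology" where
  "pointed_maps_topology X x\<^sub>0 =
     subtopology (compact_open_topology X X) (pointed_maps X x\<^sub>0)"

definition pointed_maps_monoid :: "'a topology \<Rightarrow> 'a \<Rightarrow> ('a \<Rightarrow> 'a) monoid" where
  "pointed_maps_monoid X x\<^sub>0 =
     \<lparr>carrier = pointed_maps X x\<^sub>0, mult = compose (topspace X), one = (\<lambda>x\<in>topspace X. x)\<rparr>"

definition unit_interval_monoid :: "real monoid" where
  "unit_interval_monoid = \<lparr>carrier = {0..1}, mult = (*), one = 1\<rparr>"

lemma monoid_unit_interval_monoid: "monoid unit_interval_monoid"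
  by (rule monoidI) (auto simp: unit_interval_monoid_def mult_le_one)

lemma monoid_pointed_maps_monoid:
  assumes "x\<^sub>0 \<in> topspace X"
  shows "monoid (pointed_maps_monoid X x\<^sub>0)"
proof -
  have cont: "continuous_map X X (\<lambda>x. f (g x))"
    if "continuous_map X X f" "continuous_map X X g" for f g
    using continuous_map_compose[OF that(2,1)] by (simp add: comp_def)
  have ident: "continuous_map X X (\<lambda>x\<in>topspace X. x)"
    by (rule continuous_map_eq[OF continuous_map_id]) simp
  have maps: "f x \<in> topspace X" if "continuous_map X X f" "x \<in> topspace X" for f x
    using that by (auto simp: continuous_map_def)
  show ?thesis
    by (rule monoidI)
      (use assms maps in \<open>auto simp: pointed_maps_monoid_def pointed_maps_def cmaps_def cont ident
        compose_def fun_eq_iff extensional_def\<close>)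
qed

(* The cone C_p(I, C): the underlying set {p} + (I - {0}) x C is realised in a sum type,
   with Inl p the apex. *)
definition cone_space :: "'p \<Rightarrow> real set \<Rightarrow> 'c topology \<Rightarrow> ('p + real \<times> 'c) set" where
  "cone_space p I C = insert (Inl p) (Inr ` ((I - {0}) \<times> topspace C))"

definition cone_proj :: "'p \<Rightarrow> real \<times> 'c \<Rightarrow> 'p + real \<times> 'c" where
  "cone_proj p = (\<lambda>(t, c). if t = 0 then Inl p else Inr (t, c))"

definition cone_topology :: "'p \<Rightarrow> real set \<Rightarrow> 'c topology \<Rightarrow> ('p + real \<times> 'c) topology" where
  "cone_topology p I C = topology (\<lambda>U. U \<subseteq> cone_space p I C \<and>
     openin (prod_topology (top_of_set I) C) {z \<in> I \<times> topspace C. cone_proj p z \<in> U})"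

lemma cone_proj_in_cone_space:
  "z \<in> I \<times> topspace C \<Longrightarrow> cone_proj p z \<in> cone_space p I C"
  by (cases "fst z = 0") (auto simp: cone_proj_def cone_space_def)

lemma openin_cone_topology:
  "openin (cone_topology p I C) U \<longleftrightarrow> U \<subseteq> cone_space p I C \<and>
     openin (prod_topology (top_of_set I) C) {z \<in> I \<times> topspace C. cone_proj p z \<in> U}"
proof -
  let ?P = "prod_topology (top_of_set I) C"
  let ?V = "\<lambda>U. {z \<in> I \<times> topspace C. cone_proj p z \<in> U}"
  have int: "?V (S \<inter> T) = ?V S \<inter> ?V T" for S T by blast
  have un: "?V (\<Union>K) = (\<Union>S\<in>K. ?V S)" for K by blast
  have "istopology (\<lambda>U. U \<subseteq> cone_space p I C \<and> openin ?P (?V U))"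
    unfolding istopology_def int un by (blast intro: openin_Int openin_Union)
  then show ?thesis
    unfolding cone_topology_def by (simp add: topology_inverse')
qed

lemma topspace_cone_topology [simp]:
  "topspace (cone_topology p I C) = cone_space p I C"
proof -
  have "{z \<in> I \<times> topspace C. cone_proj p z \<in> cone_space p I C}
        = topspace (prod_topology (top_of_set I) C)"
    using cone_proj_in_cone_space by fastforce
  then have "openin (cone_topology p I C) (cone_space p I C)"
    unfolding openin_cone_topology using openin_topspace by (metis order_refl)
  then show ?thesis
    by (meson openin_cone_topology openin_subset openin_topspace subset_antisym)
qed

lemma quotient_map_cone_proj:
  assumes "0 \<in> I" "topspace C \<noteq> {}"
  shows "quotient_map (prod_topology (top_of_set I) C) (cone_topology p I C) (cone_proj p)"
proof -
  have "cone_proj p ` (I \<times> topspace C) = cone_space p I C"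
  proof
    show "cone_proj p ` (I \<times> topspace C) \<subseteq> cone_space p I C"
      using cone_proj_in_cone_space by fastforce
    obtain c where "c \<in> topspace C" using assms(2) by blast
    then have "Inl p \<in> cone_proj p ` (I \<times> topspace C)"
      using assms(1) by (force simp: cone_proj_def)
    moreover have "Inr (t, d) \<in> cone_proj p ` (I \<times> topspace C)"
      if "t \<in> I - {0}" "d \<in> topspace C" for t d
      using that by (intro image_eqI[of _ _ "(t, d)"]) (auto simp: cone_proj_def)
    ultimately show "cone_space p I C \<subseteq> cone_proj p ` (I \<times> topspace C)"
      by (auto simp: cone_space_def)
  qed
  then show ?thesis
    by (simp add: quotient_map_def openin_cone_topology)
qed

end

theory Submission
  imports Defs
begin

text \<open>
  Joint continuity of \<open>(\<alpha>, y) \<mapsto> F(\<alpha>)(y)\<close> and compactness of \<open>[0,1] \<times> X\<close> make the set of \<open>\<alpha>\<close> with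
  \<open>x \<in> F(\<alpha>)(X)\<close> closed. For \<open>x \<noteq> x\<^sub>0\<close> its least element \<open>\<alpha>\<close> is positive, and the preimage of \<open>x\<close>
  under \<open>F(\<alpha>)\<close> lies in \<open>C\<close>: were it \<open>F(\<beta>)(z)\<close> with \<open>\<beta> < 1\<close>, then \<open>x = F(\<alpha>\<beta>)(z)\<close> would contradict
  minimality. For \<open>\<alpha> < \<beta>\<close>, writing \<open>F(\<alpha>) = F(\<beta>) \<circ> F(\<alpha>/\<beta>)\<close> and cancelling the injective \<open>F(\<beta>)\<close>
  puts any common point of \<open>F(\<alpha>)(C)\<close> and \<open>F(\<beta>)(C)\<close> in the image of \<open>F(\<alpha>/\<beta>)\<close>, which misses \<open>C\<close>.
  If \<open>D\<close> is open, the cone over the compact set \<open>C\<close> is compact, so the continuous bijection onto the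
  Hausdorff space \<open>X\<close> is a homeomorphism.
\<close>

lemma openin_compact_open_topology:
  assumes "compactin X K" "openin Y U"
  shows "openin (compact_open_topology X Y) {f \<in> cmaps X Y. f ` K \<subseteq> U}"
  unfolding compact_open_topology_def
  by (rule topology_generated_by_Basis) (use assms in blast)

text \<open>Near \<open>(t, x)\<close>, local compactness gives a compact neighbourhood
  \<open>K\<close> of \<open>x\<close> that \<open>G t\<close> sends into \<open>U\<close>. The maps
  sending \<open>K\<close> into \<open>U\<close> form a subbasic open set, whose preimage under
  \<open>G\<close> is a neighbourhood of \<open>t\<close>; this controls both variables at
  once.\<close>

lemma continuous_map_uncurry_compact_open:
  assumes nb: "neighbourhood_base_of (compactin X) X"
    and G: "continuous_map Z (compact_open_topology X Y) G"
  shows "continuous_map (prod_topology Z X) Y (\<lambda>(t, x). G t x)"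
proof -
  have G_cmaps: "G t \<in> cmaps X Y" if "t \<in> topspace Z" for t
    using continuous_map_image_subset_topspace[OF G] that by auto
  then have G_cont: "continuous_map X Y (G t)" if "t \<in> topspace Z" for t
    using that by (simp add: cmaps_def)
  show ?thesis
    unfolding continuous_map
  proof (intro conjI allI impI)
    show "(\<lambda>(t, x). G t x) ` topspace (prod_topology Z X) \<subseteq> topspace Y"
      using continuous_map_image_subset_topspace[OF G_cont] by fastforce
  next
    fix U assume U: "openin Y U"
    let ?S = "{z \<in> topspace (prod_topology Z X). (\<lambda>(t, x). G t x) z \<in> U}"
    show "openin (prod_topology Z X) ?S"
      unfolding openin_prod_topology_alt
    proof (intro allI impI)
      fix t x assume "(t, x) \<in> ?S"
      then have t: "t \<in> topspace Z" and x: "x \<in> topspace X" and tx: "G t x \<in> U" by auto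
      have "openin X {y \<in> topspace X. G t y \<in> U}"
        using openin_continuous_map_preimage[OF G_cont[OF t] U] .
      then obtain V K where V: "openin X V" and K: "compactin X K"
        and xV: "x \<in> V" and VK: "V \<subseteq> K" and KU: "K \<subseteq> {y \<in> topspace X. G t y \<in> U}"
        using nb x tx unfolding neighbourhood_base_of
        by (smt (verit, best) mem_Collect_eq)
      let ?W = "{s \<in> topspace Z. G s \<in> {f \<in> cmaps X Y. f ` K \<subseteq> U}}"
      have "openin Z ?W"
        using openin_continuous_map_preimage[OF G openin_compact_open_topology[OF K U]] .
      moreover have "t \<in> ?W"
        using t KU G_cmaps by auto
      moreover have "?W \<times> V \<subseteq> ?S"
        using VK openin_subset[OF V] by auto
      ultimately show "\<exists>A B. openin Z A \<and> openin X B \<and> t \<in> A \<and> x \<in> B \<and> A \<times> B \<subseteq> ?S"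
        using V xV by blast
    qed
  qed
qed

text \<open>The cone is the image of the compact product under \<open>cone_proj\<close>.
  Nonemptiness of \<open>C\<close> ensures that the apex is hit, by some
  \<open>(0, c)\<close>.\<close>

lemma compact_space_cone_topology:
  assumes "compact I" "0 \<in> I" "compact_space C" "topspace C \<noteq> {}"
  shows "compact_space (cone_topology p I C)"
proof -
  have "compact_space (prod_topology (top_of_set I) C)"
    using assms by (simp add: compact_space_prod_topology compact_space_subtopology)
  then have "compactin (cone_topology p I C)
      (cone_proj p ` topspace (prod_topology (top_of_set I) C))"
    using quotient_imp_continuous_map[OF quotient_map_cone_proj[OF assms(2,4)]]
    unfolding compact_space_def by (rule image_compactin)
  then show ?thesis
    using quotient_imp_surjective_map[OF quotient_map_cone_proj[OF assms(2,4)]]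
    unfolding compact_space_def by metis
qed

theorem proposition2p8:
  fixes X :: "'a topology" and x\<^sub>0 :: 'a and F :: "real \<Rightarrow> 'a \<Rightarrow> 'a" and D C :: "'a set"
  assumes "compact_space X" and "Hausdorff_space X" and "x\<^sub>0 \<in> topspace X"
    and "F \<in> hom unit_interval_monoid (pointed_maps_monoid X x\<^sub>0)"
    and "continuous_map (top_of_set {0..1}) (pointed_maps_topology X x\<^sub>0) F"
    and "inj_on F {0..1}"
    and "F 0 = (\<lambda>x\<in>topspace X. x\<^sub>0)"
    and "F 1 = (\<lambda>x\<in>topspace X. x)"
    and "\<And>\<alpha>. \<alpha> \<in> {0<..1} \<Longrightarrow> inj_on (F \<alpha>) (topspace X)"
    and "D = (\<Union>\<alpha>\<in>{0..<1}. F \<alpha> ` topspace X)"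
    and "C = topspace X - D"
  shows "((\<forall>\<alpha>\<in>{0..1}. F \<alpha> ` C \<noteq> {}) \<and>
          disjoint_family_on (\<lambda>\<alpha>. F \<alpha> ` C) {0..1} \<and>
          (\<Union>\<alpha>\<in>{0..1}. F \<alpha> ` C) = topspace X) \<and>
         (openin X D \<longrightarrow>
          homeomorphic_map (cone_topology x\<^sub>0 {0..1} (subtopology X C)) X
            (case_sum (\<lambda>_. x\<^sub>0) (\<lambda>(\<alpha>, c). F \<alpha> c)))"
proof -
  let ?I = "top_of_set {0..1::real}"
  let ?f = "case_sum (\<lambda>_. x\<^sub>0) (\<lambda>(\<alpha>, c). F \<alpha> c)"
  have maps: "F \<alpha> y \<in> topspace X" if "\<alpha> \<in> {0..1}" "y \<in> topspace X" for \<alpha> y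
    using assms(4) that
    by (force simp: hom_def unit_interval_monoid_def pointed_maps_monoid_def pointed_maps_def
        cmaps_def continuous_map_def)
  have mult: "F (\<alpha> * \<beta>) y = F \<alpha> (F \<beta> y)"
    if "\<alpha> \<in> {0..1}" "\<beta> \<in> {0..1}" "y \<in> topspace X" for \<alpha> \<beta> y
    using assms(4) that
    by (simp add: hom_def unit_interval_monoid_def pointed_maps_monoid_def compose_def)
  have F0: "F 0 y = x\<^sub>0" and F1: "F 1 y = y" if "y \<in> topspace X" for y
    using that assms(7,8) by auto
  have CX: "C \<subseteq> topspace X" using assms(11) by blast
  have inj_D: "F \<alpha> y \<in> D" if "\<alpha> \<in> {0..<1}" "y \<in> topspace X" for \<alpha> y
    using that assms(10) by blast
  have "neighbourhood_base_of (compactin X) X"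
    using assms(1,2) locally_compact_space_neighbourhood_base compact_imp_locally_compact_space
    by blast
  moreover have "continuous_map ?I (compact_open_topology X X) F"
    using assms(5) by (simp add: pointed_maps_topology_def continuous_map_in_subtopology)
  ultimately have joint: "continuous_map (prod_topology ?I X) X (\<lambda>(\<alpha>, y). F \<alpha> y)"
    by (rule continuous_map_uncurry_compact_open)
  have unique: False
    if "\<alpha> \<in> {0..1}" "\<beta> \<in> {0..1}" "\<alpha> < \<beta>" "c \<in> C" "d \<in> C" "F \<alpha> c = F \<beta> d" for \<alpha> \<beta> c d
  proof -
    \<comment> \<open>Here \<beta> is positive because 0 \<le> \<alpha> < \<beta>, so the quotient
      is a genuine parameter below 1 and \<open>F \<beta>\<close> is injective.\<close>
    have q: "\<alpha> / \<beta> \<in> {0..<1}" "\<beta> * (\<alpha> / \<beta>) = \<alpha>" using that by auto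
    have "F \<beta> (F (\<alpha> / \<beta>) c) = F \<beta> d"
      using mult[of \<beta> "\<alpha> / \<beta>" c] that q CX by auto
    then have "F (\<alpha> / \<beta>) c = d"
      using assms(9)[of \<beta>] maps[of "\<alpha> / \<beta>" c] that q CX by (auto simp: inj_on_def)
    then show False
      using inj_D[OF q(1)] that CX assms(11) by blast
  qed
  have eq_param: "\<alpha> = \<beta>"
    if "\<alpha> \<in> {0..1}" "\<beta> \<in> {0..1}" "c \<in> C" "d \<in> C" "F \<alpha> c = F \<beta> d" for \<alpha> \<beta> c d
    using unique[of \<alpha> \<beta> c d] unique[of \<beta> \<alpha> d c] that by (metis linorder_neq_iff)
  have cover: "\<exists>\<alpha>\<in>{0<..1}. \<exists>c\<in>C. x = F \<alpha> c" if x: "x \<in> topspace X" "x \<noteq> x\<^sub>0" for x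
  proof -
    let ?P = "{z \<in> topspace (prod_topology ?I X). (\<lambda>(\<alpha>, y). F \<alpha> y) z \<in> {x}}"
    have "closedin (prod_topology ?I X) ?P"
      using closedin_continuous_map_preimage[OF joint] closedin_Hausdorff_singleton[OF assms(2) x(1)]
      by blast
    moreover have "compact_space (prod_topology ?I X)"
      using assms(1) by (simp add: compact_space_prod_topology compact_space_subtopology)
    \<comment> \<open>The projection of \<open>?P\<close> is the set of parameters \<alpha> for
      which \<open>x\<close> lies in the image of \<open>F \<alpha>\<close>.\<close>
    ultimately have "compactin ?I (fst ` ?P)"
      using closedin_compact_space continuous_map_fst image_compactin by blast
    then have cpt: "compact (fst ` ?P)"
      by (simp add: compactin_subtopology)
    have "(1, x) \<in> ?P" using x F1 by auto
    then have "fst ` ?P \<noteq> {}" by blast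
    from compact_attains_inf[OF cpt this]
    obtain \<alpha> y where \<alpha>: "\<alpha> \<in> {0..1}" "y \<in> topspace X" "F \<alpha> y = x"
      and least: "\<And>\<beta> z. \<beta> \<in> {0..1} \<Longrightarrow> z \<in> topspace X \<Longrightarrow> F \<beta> z = x \<Longrightarrow> \<alpha> \<le> \<beta>"
      by fastforce
    have pos: "\<alpha> > 0" using \<alpha> F0 x by (cases "\<alpha> = 0") auto
    have "y \<notin> D"
    proof
      assume "y \<in> D"
      then obtain \<beta> z where \<beta>: "\<beta> \<in> {0..<1}" "z \<in> topspace X" "y = F \<beta> z"
        using assms(10) by blast
      have "F (\<alpha> * \<beta>) z = x" using mult[of \<alpha> \<beta> z] \<alpha> \<beta> by auto
      then have "\<alpha> \<le> \<alpha> * \<beta>"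
        using least[of "\<alpha> * \<beta>" z] \<alpha> \<beta> by (auto simp: mult_le_one)
      then show False using pos \<beta> by auto
    qed
    then show ?thesis using \<alpha> pos assms(11) by force
  qed
  \<comment> \<open>On a one-point space the constant map and the identity coincide, against the
    injectivity of \<open>F\<close>. Applying \<open>cover\<close> to a second point then produces
    an element of \<open>C\<close>.\<close>
  have "\<exists>x\<in>topspace X. x \<noteq> x\<^sub>0"
  proof (rule ccontr)
    assume "\<not> ?thesis"
    then have "F 0 = F 1" unfolding assms(7,8) by (auto simp: restrict_def)
    then show False using inj_onD[OF assms(6), of 0 1] by simp
  qed
  then have C_ne: "C \<noteq> {}" using cover by blast
  \<comment> \<open>The base point, left out by \<open>cover\<close>, is the whole block at
    parameter 0.\<close>
  have x0: "x\<^sub>0 \<in> F 0 ` C" using C_ne CX F0 by force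
  have partition: "(\<forall>\<alpha>\<in>{0..1}. F \<alpha> ` C \<noteq> {}) \<and>
          disjoint_family_on (\<lambda>\<alpha>. F \<alpha> ` C) {0..1} \<and>
          (\<Union>\<alpha>\<in>{0..1}. F \<alpha> ` C) = topspace X"
  proof (intro conjI)
    show "\<forall>\<alpha>\<in>{0..1}. F \<alpha> ` C \<noteq> {}" using C_ne by blast
    show "disjoint_family_on (\<lambda>\<alpha>. F \<alpha> ` C) {0..1}"
      unfolding disjoint_family_on_def using eq_param by blast
    have "x \<in> (\<Union>\<alpha>\<in>{0..1}. F \<alpha> ` C)" if x: "x \<in> topspace X" for x
    proof (cases "x = x\<^sub>0")
      case True
      then show ?thesis using x0 by force
    next
      case False
      then obtain \<alpha> c where "\<alpha> \<in> {0<..1}" "c \<in> C" "x = F \<alpha> c"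
        using cover x by blast
      then show ?thesis by (intro UN_I[of \<alpha>]) auto
    qed
    then show "(\<Union>\<alpha>\<in>{0..1}. F \<alpha> ` C) = topspace X" using maps CX by blast
  qed
  have "homeomorphic_map (cone_topology x\<^sub>0 {0..1} (subtopology X C)) X ?f" if D: "openin X D"
  proof -
    let ?C = "subtopology X C"
    let ?cone = "cone_topology x\<^sub>0 {0..1} ?C"
    have topC: "topspace ?C = C" using CX by auto
    \<comment> \<open>Openness of \<open>D\<close> enters here: it makes \<open>C\<close> closed in
      the compact space \<open>X\<close>.\<close>
    have "compact_space ?C"
      using D assms(1,11) closedin_compact_space compact_space_subtopology by blast
    then have cpt: "compact_space ?cone"
      using C_ne topC by (intro compact_space_cone_topology) auto
    have "continuous_map (prod_topology ?I ?C) X (\<lambda>(\<alpha>, y). F \<alpha> y)"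
      using continuous_map_from_subtopology[OF joint, of "UNIV \<times> C"]
      by (simp only: subtopology_Times subtopology_UNIV)
    \<comment> \<open>By the universal property of the quotient, continuity of \<open>?f\<close> can
      be tested on the product. There the composite is \<open>F \<alpha> y\<close>, also at \<alpha>
      = 0, where both sides are \<open>x\<^sub>0\<close>.\<close>
    then have "continuous_map (prod_topology ?I ?C) X (?f \<circ> cone_proj x\<^sub>0)"
      by (rule continuous_map_eq) (use F0 in \<open>auto simp: cone_proj_def\<close>)
    then have cont: "continuous_map ?cone X ?f"
      using continuous_compose_quotient_map[OF quotient_map_cone_proj[of "{0..1}" ?C x\<^sub>0]] C_ne topC
      by auto
    have apex: "F \<alpha> c \<noteq> x\<^sub>0" if "\<alpha> \<in> {0<..1}" "c \<in> C" for \<alpha> c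
      \<comment> \<open>Since \<open>F 0 c\<close> is \<open>x\<^sub>0\<close>, a positive \<alpha>
        reaching the base point would have to equal 0.\<close>
      using eq_param[of \<alpha> 0 c c] F0[of c] that CX by auto
    have inj: "inj_on ?f (topspace ?cone)"
    proof (rule inj_onI)
      fix u v assume "u \<in> topspace ?cone" "v \<in> topspace ?cone" and eq: "?f u = ?f v"
      then have "u = Inl x\<^sub>0 \<or> (\<exists>\<alpha>\<in>{0<..1}. \<exists>c\<in>C. u = Inr (\<alpha>, c))"
        "v = Inl x\<^sub>0 \<or> (\<exists>\<alpha>\<in>{0<..1}. \<exists>c\<in>C. v = Inr (\<alpha>, c))"
        by (force simp: cone_space_def)+
      \<comment> \<open>The second case stands for exactly one of \<open>u\<close>, \<open>v\<close>
        being the apex, whichever it is.\<close>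
      then consider "u = v" | \<alpha> c where "\<alpha> \<in> {0<..1}" "c \<in> C" "F \<alpha> c = x\<^sub>0"
        | \<alpha> c \<beta> d where "\<alpha> \<in> {0<..1}" "c \<in> C" "\<beta> \<in> {0<..1}" "d \<in> C" "F \<alpha> c = F \<beta> d"
          "u = Inr (\<alpha>, c)" "v = Inr (\<beta>, d)"
        using eq by fastforce
      then show "u = v"
      proof cases
        case 1
        then show ?thesis .
      next
        case 2
        then show ?thesis using apex by blast
      next
        case 3
        then have "\<alpha> = \<beta>" using eq_param[of \<alpha> \<beta> c d] by auto
        moreover have "c = d"
          using inj_onD[OF assms(9)[of \<alpha>], of c d] 3 \<open>\<alpha> = \<beta>\<close> CX by auto
        ultimately show ?thesis using 3 by simp
      qed
    qed
    have "topspace X \<subseteq> ?f ` topspace ?cone"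
    proof
      fix x assume x: "x \<in> topspace X"
      show "x \<in> ?f ` topspace ?cone"
      proof (cases "x = x\<^sub>0")
        case True
        then show ?thesis by (intro image_eqI[of _ _ "Inl x\<^sub>0"]) (auto simp: cone_space_def)
      next
        case False
        then obtain \<alpha> c where "\<alpha> \<in> {0<..1}" "c \<in> C" "x = F \<alpha> c"
          using cover x by blast
        then show ?thesis
          using CX by (intro image_eqI[of _ _ "Inr (\<alpha>, c)"]) (auto simp: cone_space_def)
      qed
    qed
    then have "?f ` topspace ?cone = topspace X"
      using continuous_map_image_subset_topspace[OF cont] by blast
    then show ?thesis
      using continuous_imp_homeomorphic_map[OF cont cpt assms(2)] inj by blast
  qed
  then show ?thesis using partition by blast
qed

end
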